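(* Let $\gamma : I\to\mathbb{R}^3$ be a smooth curve on an open interval $I$ parametrized by arc length $s$, with nowhere vanishing curvature and unit tangent $T$. Let $c$ be a real constant with $c-s>0$ for all $s\in I$, and let $\widetilde\gamma=\gamma+(c-s)T$ be the involute of $\gamma$, assumed to have nowhere zero torsion. Then the binormal indicatrix $\widetilde\gamma_b$ of $\widetilde\gamma$ is a circle if and only if $\gamma$ is a slant helix.
   Context: The binormal indicatrix $\widetilde\gamma_b$ of $\widetilde\gamma$ is the curve traced on the unit sphere by its unit binormal vector $\widetilde B$. "Is a circle" means that the indicatrix lies on (is an arc of) the intersection of the unit sphere with a plane. For a curve with arc-length parameter $u$, curvature $k>0$, torsion $t$ and $g=t/k$, the curve is a slant helix if its principal normal lines make a constant angle with a fixed direction; equivalently (known characterization of Izumiya and Takeuchi), the function $\frac{dg/du}{k(1+g^2)^{3/2}}$ is constant. *)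

theory Defs
  imports "HOL-Analysis.Analysis"
begin

definition vderiv :: "(real \<Rightarrow> 'a::real_normed_vector) \<Rightarrow> real \<Rightarrow> 'a" where
  "vderiv f = (\<lambda>s. vector_derivative f (at s))"

text \<open>C-infinity on an open set of parameters: every iterated derivative is again differentiable.\<close>

definition smooth_curve_on :: "real set \<Rightarrow> (real \<Rightarrow> 'a::real_normed_vector) \<Rightarrow> bool" where
  "smooth_curve_on I f \<longleftrightarrow> (\<forall>n. \<forall>s\<in>I. (vderiv ^^ n) f differentiable (at s))"

definition arc_length_param_on :: "real set \<Rightarrow> (real \<Rightarrow> real^3) \<Rightarrow> bool" where
  "arc_length_param_on I \<alpha> \<longleftrightarrow> (\<forall>s\<in>I. norm (vderiv \<alpha> s) = 1)"

text \<open>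
  The Frenet apparatus is defined for an arbitrary regular parameter, because the parameter inherited
  by an involute is in general not its arc length.  With \<open>u\<close> an arc-length parameter,
  \<open>d/du = (1 / norm \<alpha>') d/ds\<close>, so that \<open>curvature\<close> is \<open>norm (dT/du)\<close> and \<open>torsion\<close> is the
  function in \<open>dB/du = - torsion *\<^sub>R N\<close>.
\<close>

definition unit_tangent :: "(real \<Rightarrow> real^3) \<Rightarrow> real \<Rightarrow> real^3" where
  "unit_tangent \<alpha> s = sgn (vderiv \<alpha> s)"

definition curvature :: "(real \<Rightarrow> real^3) \<Rightarrow> real \<Rightarrow> real" where
  "curvature \<alpha> s = norm (vderiv (unit_tangent \<alpha>) s) / norm (vderiv \<alpha> s)"

definition principal_normal :: "(real \<Rightarrow> real^3) \<Rightarrow> real \<Rightarrow> real^3" where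
  "principal_normal \<alpha> s = sgn (vderiv (unit_tangent \<alpha>) s)"

definition binormal :: "(real \<Rightarrow> real^3) \<Rightarrow> real \<Rightarrow> real^3" where
  "binormal \<alpha> s = cross3 (unit_tangent \<alpha> s) (principal_normal \<alpha> s)"

definition torsion :: "(real \<Rightarrow> real^3) \<Rightarrow> real \<Rightarrow> real" where
  "torsion \<alpha> s = - (vderiv (binormal \<alpha>) s \<bullet> principal_normal \<alpha> s) / norm (vderiv \<alpha> s)"

definition involute :: "real \<Rightarrow> (real \<Rightarrow> real^3) \<Rightarrow> real \<Rightarrow> real^3" where
  "involute c \<gamma> s = \<gamma> s + (c - s) *\<^sub>R unit_tangent \<gamma> s"

definition is_plane :: "(real^3) set \<Rightarrow> bool" where
  "is_plane P \<longleftrightarrow> (\<exists>n a. n \<noteq> 0 \<and> P = {x. n \<bullet> x = a})"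

text \<open>A spherical curve is a circle if its trace is contained in a plane section of the unit sphere.\<close>

definition spherical_circle_on :: "real set \<Rightarrow> (real \<Rightarrow> real^3) \<Rightarrow> bool" where
  "spherical_circle_on I \<beta> \<longleftrightarrow> (\<exists>P. is_plane P \<and> \<beta> ` I \<subseteq> sphere 0 1 \<inter> P)"

definition vec_angle :: "'a::real_inner \<Rightarrow> 'a \<Rightarrow> real" where
  "vec_angle x y = arccos ((x \<bullet> y) / (norm x * norm y))"

text \<open>The normal lines are oriented by the (continuous) principal normal vector field.\<close>

definition slant_helix_on :: "real set \<Rightarrow> (real \<Rightarrow> real^3) \<Rightarrow> bool" where
  "slant_helix_on I \<alpha> \<longleftrightarrow>
    (\<exists>d \<theta>. d \<noteq> 0 \<and> (\<forall>s\<in>I. vec_angle (principal_normal \<alpha> s) d = \<theta>))"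

end

theory Submission
  imports Defs
begin

unbundle cross3_syntax

text \<open>
  Differentiating \<open>\<gamma> + (c - s) T\<close> cancels the tangential part and leaves \<open>(c - s) k N\<close>, so, as
  \<open>c - s\<close> is positive, the unit tangent of the involute is the principal normal \<open>N\<close> of \<open>\<gamma>\<close>
  (\<open>unit_tangent_involute\<close>).  Hence \<open>\<gamma>\<close> is a slant helix if and only if the unit tangent of its
  involute has constant inner product with some nonzero vector \<open>d\<close>, whereas the binormal indicatrix of
  the involute is a circle if and only if its binormal has constant inner product with some nonzero
  \<open>d\<close>.

  These two conditions hold for the same vectors \<open>d\<close>, for any curve with nonvanishing torsion: the
  Frenet equations make the derivatives of the tangent and of the binormal nonzero multiples of the
  principal normal of that curve, so each of the two inner products is constant exactly when \<open>d\<close> is orthogonal to the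
  principal normal throughout (\<open>tangent_height_constant_iff_binormal_height_constant\<close>).  This is the
  classical fact that for a general helix the tangent and the binormal make constant angles with the
  same axis.

  The remaining work is regularity: the binormal of the involute involves three derivatives of \<open>\<gamma>\<close>
  through two normalisations, and normalising a nonvanishing field preserves differentiability.
\<close>

section \<open>Derivatives of vector fields along an open parameter set\<close>

lemma vderiv_works:
  "f differentiable (at s) \<longleftrightarrow> (f has_vector_derivative vderiv f s) (at s)"
  by (simp add: vderiv_def vector_derivative_works)

lemma vderiv_eqI: "(f has_vector_derivative D) (at s) \<Longrightarrow> vderiv f s = D"
  by (simp add: vderiv_def vector_derivative_at)

lemma vderiv_cong_open:
  assumes "open I" "s \<in> I" "\<And>t. t \<in> I \<Longrightarrow> f t = g t"
  shows "vderiv f s = vderiv g s"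
proof -
  have "(f has_vector_derivative D) (at s) \<longleftrightarrow> (g has_vector_derivative D) (at s)" for D
    using assms by (metis has_vector_derivative_transform_within_open)
  then show ?thesis
    by (simp add: vderiv_def vector_derivative_def)
qed

lemma differentiable_cong_open:
  fixes f g :: "real \<Rightarrow> 'a::real_normed_vector"
  assumes "f differentiable (at s)" "open I" "s \<in> I" "\<And>t. t \<in> I \<Longrightarrow> f t = g t"
  shows "g differentiable (at s)"
  using assms has_vector_derivative_transform_within_open differentiableI_vector vderiv_works
  by metis

lemma has_real_derivative_inner_const:
  fixes f :: "real \<Rightarrow> 'a::real_inner"
  assumes "(f has_vector_derivative D) (at s)"
  shows "((\<lambda>t. f t \<bullet> d) has_real_derivative D \<bullet> d) (at s)"
  using bounded_linear.has_vector_derivative[OF bounded_linear_inner_left assms]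
  by (simp add: has_real_derivative_iff_has_vector_derivative)

lemma has_vector_derivative_inner:
  fixes f g :: "real \<Rightarrow> 'a::real_inner"
  assumes "(f has_vector_derivative f') (at s)" "(g has_vector_derivative g') (at s)"
  shows "((\<lambda>t. f t \<bullet> g t) has_vector_derivative (f s \<bullet> g' + f' \<bullet> g s)) (at s)"
  using bounded_bilinear.has_vector_derivative[OF bounded_bilinear_inner assms] .

lemma has_vector_derivative_cross3:
  assumes "(f has_vector_derivative f') (at s)" "(g has_vector_derivative g') (at s)"
  shows "((\<lambda>t. f t \<times> g t) has_vector_derivative (f s \<times> g' + f' \<times> g s)) (at s)"
proof -
  have "bounded_bilinear (\<times>)"
    using bilinear_cross by (simp add: bilinear_conv_bounded_bilinear)
  then show ?thesis
    using assms by (rule bounded_bilinear.has_vector_derivative)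
qed

lemma unit_field_orthogonal_derivative:
  fixes f :: "real \<Rightarrow> 'a::real_inner"
  assumes "open I" "s \<in> I" "\<And>t. t \<in> I \<Longrightarrow> norm (f t) = 1"
    and f: "(f has_vector_derivative D) (at s)"
  shows "f s \<bullet> D = 0"
proof -
  have "((\<lambda>t. f t \<bullet> f t) has_vector_derivative 0) (at s)"
    by (rule has_vector_derivative_transform_within_open[of "\<lambda>_. 1" _ _ I])
      (use assms in \<open>auto simp: norm_eq_1\<close>)
  with has_vector_derivative_inner[OF f f] have "f s \<bullet> D + D \<bullet> f s = 0"
    by (rule vector_derivative_unique_at)
  then show ?thesis
    by (simp add: inner_commute)
qed

lemma inner_constant_iff_derivative_orthogonal:
  fixes f :: "real \<Rightarrow> 'a::real_inner"
  assumes "open I" "is_interval I" "\<And>s. s \<in> I \<Longrightarrow> f differentiable (at s)"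
  shows "(\<exists>a. \<forall>s\<in>I. f s \<bullet> d = a) \<longleftrightarrow> (\<forall>s\<in>I. vderiv f s \<bullet> d = 0)"
proof
  have D: "((\<lambda>t. f t \<bullet> d) has_real_derivative vderiv f s \<bullet> d) (at s)" if "s \<in> I" for s
    using assms(3)[OF that] by (simp add: vderiv_works has_real_derivative_inner_const)
  show "\<forall>s\<in>I. vderiv f s \<bullet> d = 0" if "\<exists>a. \<forall>s\<in>I. f s \<bullet> d = a"
  proof
    fix s assume s: "s \<in> I"
    from that obtain a where a: "\<forall>s\<in>I. f s \<bullet> d = a" ..
    have "((\<lambda>t. f t \<bullet> d) has_real_derivative 0) (at s)"
      by (rule has_field_derivative_transform_within_open[of "\<lambda>_. a" _ _ I])
        (use assms(1) s a in auto)
    with D[OF s] show "vderiv f s \<bullet> d = 0"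
      by (rule DERIV_unique)
  qed
  show "\<exists>a. \<forall>s\<in>I. f s \<bullet> d = a" if "\<forall>s\<in>I. vderiv f s \<bullet> d = 0"
  proof (rule has_field_derivative_zero_constant)
    show "convex I"
      using assms(2) by (rule is_interval_convex)
    show "((\<lambda>t. f t \<bullet> d) has_real_derivative 0) (at s within I)" if "s \<in> I" for s
      using D[OF that] \<open>\<forall>s\<in>I. vderiv f s \<bullet> d = 0\<close> that has_field_derivative_at_within by fastforce
  qed
qed

lemma has_vector_derivative_sgn:
  fixes f :: "real \<Rightarrow> 'a::real_inner"
  assumes f: "(f has_vector_derivative D) (at s)" and "f s \<noteq> 0"
  shows "((\<lambda>t. sgn (f t)) has_vector_derivative
           (1 / norm (f s)) *\<^sub>R D - ((f s \<bullet> D) / norm (f s) ^ 3) *\<^sub>R f s) (at s)"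
proof -
  have n: "((\<lambda>t. norm (f t)) has_real_derivative D \<bullet> sgn (f s)) (at s)"
    using has_derivative_compose[OF f[unfolded has_vector_derivative_def]
        has_derivative_norm[OF \<open>f s \<noteq> 0\<close>]]
    by (simp add: has_field_derivative_def mult.commute mult_commute_abs)
  have "((\<lambda>t. inverse (norm (f t))) has_real_derivative
          - (inverse (norm (f s)) * (D \<bullet> sgn (f s)) * inverse (norm (f s)))) (at s)"
    using DERIV_inverse'[OF n] \<open>f s \<noteq> 0\<close> by simp
  from has_vector_derivative_scaleR[OF this f] show ?thesis
    by (simp add: sgn_div_norm power3_eq_cube divide_inverse inner_commute mult.commute mult.left_commute)
qed


lemma differentiable_sgn:
  fixes f :: "real \<Rightarrow> 'a::real_inner"
  assumes "f differentiable (at s)" "f s \<noteq> 0"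
  shows "(\<lambda>t. sgn (f t)) differentiable (at s)"
  using has_vector_derivative_sgn assms differentiableI_vector vderiv_works by blast

lemma twice_differentiable_sgn:
  fixes f :: "real \<Rightarrow> 'a::real_inner"
  assumes "open I" "s \<in> I"
    and f: "\<And>t. t \<in> I \<Longrightarrow> f differentiable (at t)" "\<And>t. t \<in> I \<Longrightarrow> vderiv f differentiable (at t)"
    and "\<And>t. t \<in> I \<Longrightarrow> f t \<noteq> 0"
  shows "vderiv (\<lambda>t. sgn (f t)) differentiable (at s)"
proof (rule differentiable_cong_open[OF _ assms(1,2)])
  let ?D = "\<lambda>t. (1 / norm (f t)) *\<^sub>R vderiv f t
                - ((f t \<bullet> vderiv f t) / norm (f t) ^ 3) *\<^sub>R f t"
  have "(\<lambda>t. norm (f t)) differentiable (at s)"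
    using differentiable_chain_at[of f s norm, unfolded o_def] assms by simp
  then show "?D differentiable (at s)"
    using assms by (auto intro!: differentiable_diff differentiable_scaleR differentiable_divide
        differentiable_inner differentiable_power)
  show "?D t = vderiv (\<lambda>t. sgn (f t)) t" if "t \<in> I" for t
    using assms that by (intro vderiv_eqI[symmetric] has_vector_derivative_sgn) (auto simp: vderiv_works)
qed

section \<open>The binormal of a curve with nonvanishing torsion\<close>

text \<open>Since \<open>x / 0 = 0\<close> and \<open>sgn 0 = 0\<close>, a nonzero value of the torsion forces the
  curve to be regular with nonzero curvature there, so the Frenet frame is defined.\<close>

lemma torsion_nonzero_imp_frenet:
  assumes "torsion \<alpha> s \<noteq> 0"
  shows "vderiv \<alpha> s \<noteq> 0" "vderiv (unit_tangent \<alpha>) s \<noteq> 0"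
    "norm (unit_tangent \<alpha> s) = 1" "norm (principal_normal \<alpha> s) = 1"
  using assms by (auto simp: torsion_def unit_tangent_def principal_normal_def norm_sgn)

text \<open>The product rule for \<open>B = T \<times> N\<close> gives \<open>T' \<times> N + T \<times> N'\<close>.  The first
  term vanishes since \<open>T'\<close> is parallel to \<open>N\<close>.  The second is parallel to \<open>N\<close>, because
  \<open>N \<times> (T \<times> N') = (N \<bullet> N') T - (N \<bullet> T) N'\<close> vanishes: \<open>N'\<close> and \<open>T\<close> are both
  orthogonal to \<open>N\<close>.\<close>

lemma frenet_binormal:
  assumes "open I" "s \<in> I"
    and T: "\<And>t. t \<in> I \<Longrightarrow> unit_tangent \<alpha> differentiable (at t)"
    and N: "\<And>t. t \<in> I \<Longrightarrow> principal_normal \<alpha> differentiable (at t)"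
    and tors: "\<And>t. t \<in> I \<Longrightarrow> torsion \<alpha> t \<noteq> 0"
  shows "norm (binormal \<alpha> s) = 1"
    and "(binormal \<alpha> has_vector_derivative
           - (norm (vderiv \<alpha> s) * torsion \<alpha> s) *\<^sub>R principal_normal \<alpha> s) (at s)"
proof -
  let ?T = "unit_tangent \<alpha> s" and ?N = "principal_normal \<alpha> s"
  let ?T' = "vderiv (unit_tangent \<alpha>) s" and ?N' = "vderiv (principal_normal \<alpha>) s"
  note frenet = torsion_nonzero_imp_frenet[OF tors]
  have dT: "(unit_tangent \<alpha> has_vector_derivative ?T') (at s)"
    and dN: "(principal_normal \<alpha> has_vector_derivative ?N') (at s)"
    using T N \<open>s \<in> I\<close> by (simp_all add: vderiv_works)
  have T': "?T' = norm ?T' *\<^sub>R ?N"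
    using frenet(2)[OF \<open>s \<in> I\<close>] by (simp add: principal_normal_def sgn_div_norm)
  have NN: "?N \<bullet> ?N = 1"
    using frenet(4)[OF \<open>s \<in> I\<close>] by (simp add: norm_eq_1)
  have NN': "?N \<bullet> ?N' = 0"
    using unit_field_orthogonal_derivative[OF assms(1,2) _ dN] frenet(4) by blast
  have "?T \<bullet> ?T' = 0"
    using unit_field_orthogonal_derivative[OF assms(1,2) _ dT] frenet(3) by blast
  then have TN: "?T \<bullet> ?N = 0"
    by (simp add: principal_normal_def sgn_div_norm)
  have "(norm (binormal \<alpha> s))\<^sup>2 = 1"
    using frenet(3,4)[OF \<open>s \<in> I\<close>] TN by (simp add: binormal_def norm_cross)
  then show "norm (binormal \<alpha> s) = 1"
    by (simp add: power2_eq_1_iff) (metis norm_ge_zero not_one_le_zero neg_0_le_iff_le)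
  let ?B' = "?T \<times> ?N'"
  have "?T' \<times> ?N = 0"
    by (subst T') (simp add: cross_mult_left)
  then have dB: "(binormal \<alpha> has_vector_derivative ?B') (at s)"
    using has_vector_derivative_cross3[OF dT dN] by (simp add: binormal_def[abs_def])
  have "?N \<times> ?B' = 0"
    using NN' TN by (simp add: Lagrange inner_commute)
  then have "0 = ?N \<times> (?N \<times> ?B')"
    by simp
  also have "\<dots> = (?N \<bullet> ?B') *\<^sub>R ?N - ?B'"
    using NN by (simp add: Lagrange[of ?N ?N ?B'])
  finally have "?B' = (?N \<bullet> ?B') *\<^sub>R ?N"
    by simp
  moreover have "?N \<bullet> ?B' = - (norm (vderiv \<alpha> s) * torsion \<alpha> s)"
    using frenet(1)[OF \<open>s \<in> I\<close>] vderiv_eqI[OF dB] by (simp add: torsion_def inner_commute)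
  ultimately show "(binormal \<alpha> has_vector_derivative
           - (norm (vderiv \<alpha> s) * torsion \<alpha> s) *\<^sub>R ?N) (at s)"
    using dB by metis
qed

lemma tangent_height_constant_iff_binormal_height_constant:
  assumes I: "open I" "is_interval I"
    and T: "\<And>s. s \<in> I \<Longrightarrow> unit_tangent \<alpha> differentiable (at s)"
    and N: "\<And>s. s \<in> I \<Longrightarrow> principal_normal \<alpha> differentiable (at s)"
    and tors: "\<And>s. s \<in> I \<Longrightarrow> torsion \<alpha> s \<noteq> 0"
  shows "(\<exists>a. \<forall>s\<in>I. unit_tangent \<alpha> s \<bullet> d = a) \<longleftrightarrow> (\<exists>a. \<forall>s\<in>I. binormal \<alpha> s \<bullet> d = a)"
proof -
  note dB = frenet_binormal(2)[OF I(1) _ T N tors]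
  have B: "binormal \<alpha> differentiable (at s)" if "s \<in> I" for s
    using dB[OF that] by (rule differentiableI_vector)
  have "vderiv (unit_tangent \<alpha>) s \<bullet> d = 0 \<longleftrightarrow> principal_normal \<alpha> s \<bullet> d = 0" if "s \<in> I" for s
    using torsion_nonzero_imp_frenet(2)[OF tors[OF that]]
    by (simp add: principal_normal_def sgn_div_norm)
  moreover have "vderiv (binormal \<alpha>) s \<bullet> d = 0 \<longleftrightarrow> principal_normal \<alpha> s \<bullet> d = 0" if "s \<in> I" for s
    using torsion_nonzero_imp_frenet(1)[OF tors[OF that]] tors[OF that]
    by (simp add: vderiv_eqI[OF dB[OF that]])
  ultimately show ?thesis
    by (simp add: inner_constant_iff_derivative_orthogonal[OF I T]
        inner_constant_iff_derivative_orthogonal[OF I B])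
qed

section \<open>Circles, slant helices and heights\<close>

lemma spherical_circle_on_iff_height_constant:
  assumes "\<And>s. s \<in> I \<Longrightarrow> norm (\<beta> s) = 1"
  shows "spherical_circle_on I \<beta> \<longleftrightarrow> (\<exists>d. d \<noteq> 0 \<and> (\<exists>a. \<forall>s\<in>I. \<beta> s \<bullet> d = a))"
proof -
  have "\<beta> ` I \<subseteq> sphere 0 1"
    using assms by auto
  then have "spherical_circle_on I \<beta> \<longleftrightarrow> (\<exists>d a. d \<noteq> 0 \<and> \<beta> ` I \<subseteq> {x. d \<bullet> x = a})"
    unfolding spherical_circle_on_def is_plane_def le_inf_iff by blast
  then show ?thesis
    by (simp add: image_subset_iff inner_commute[of _ "\<beta> _"])
qed

text \<open>For unit normals the argument of the arc cosine lies in \<open>[-1, 1]\<close>, where \<open>arccos\<close> is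
  injective, so a constant angle amounts to a constant inner product.\<close>

lemma slant_helix_on_iff_height_constant:
  assumes "\<And>s. s \<in> I \<Longrightarrow> norm (principal_normal \<alpha> s) = 1"
  shows "slant_helix_on I \<alpha> \<longleftrightarrow> (\<exists>d. d \<noteq> 0 \<and> (\<exists>a. \<forall>s\<in>I. principal_normal \<alpha> s \<bullet> d = a))"
proof -
  have "(\<exists>\<theta>. \<forall>s\<in>I. vec_angle (principal_normal \<alpha> s) d = \<theta>)
      \<longleftrightarrow> (\<exists>a. \<forall>s\<in>I. principal_normal \<alpha> s \<bullet> d = a)" if "d \<noteq> 0" for d
  proof
    assume "\<exists>\<theta>. \<forall>s\<in>I. vec_angle (principal_normal \<alpha> s) d = \<theta>"
    then obtain \<theta> where \<theta>: "\<And>s. s \<in> I \<Longrightarrow> vec_angle (principal_normal \<alpha> s) d = \<theta>"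
      by blast
    have "principal_normal \<alpha> s \<bullet> d = cos \<theta> * norm d" if "s \<in> I" for s
    proof -
      have "\<bar>principal_normal \<alpha> s \<bullet> d\<bar> \<le> norm d"
        using Cauchy_Schwarz_ineq2[of "principal_normal \<alpha> s" d] assms[OF that] by simp
      then have "\<bar>principal_normal \<alpha> s \<bullet> d / norm d\<bar> \<le> 1"
        using \<open>d \<noteq> 0\<close> by (simp add: divide_le_eq_1)
      then have "cos \<theta> = principal_normal \<alpha> s \<bullet> d / norm d"
        using \<theta>[OF that] assms[OF that] by (auto simp: vec_angle_def cos_arccos_abs)
      then show ?thesis
        using \<open>d \<noteq> 0\<close> by simp
    qed
    then show "\<exists>a. \<forall>s\<in>I. principal_normal \<alpha> s \<bullet> d = a"
      by blast
  qed (use assms in \<open>auto simp: vec_angle_def\<close>)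
  then show ?thesis
    unfolding slant_helix_on_def by blast
qed

section \<open>The involute of a smooth unit-speed curve\<close>

lemma smooth_curve_on_differentiable:
  assumes "smooth_curve_on I f" "s \<in> I"
  shows "f differentiable (at s)" "vderiv f differentiable (at s)"
    "vderiv (vderiv f) differentiable (at s)" "vderiv (vderiv (vderiv f)) differentiable (at s)"
proof -
  have "(vderiv ^^ n) f differentiable (at s)" for n
    using assms by (simp add: smooth_curve_on_def)
  from this[of 0] this[of 1] this[of 2] this[of 3]
  show "f differentiable (at s)" "vderiv f differentiable (at s)"
    "vderiv (vderiv f) differentiable (at s)" "vderiv (vderiv (vderiv f)) differentiable (at s)"
    by (simp_all add: numeral_2_eq_2 numeral_3_eq_3)
qed

lemma unit_speed_frenet:
  assumes "open I" "arc_length_param_on I \<gamma>" "s \<in> I"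
  shows "unit_tangent \<gamma> s = vderiv \<gamma> s"
    and "vderiv (unit_tangent \<gamma>) s = vderiv (vderiv \<gamma>) s"
    and "principal_normal \<gamma> s = sgn (vderiv (vderiv \<gamma>) s)"
proof -
  have T: "unit_tangent \<gamma> t = vderiv \<gamma> t" if "t \<in> I" for t
    using assms(2) that by (simp add: arc_length_param_on_def unit_tangent_def sgn_div_norm)
  show "unit_tangent \<gamma> s = vderiv \<gamma> s"
    using T assms(3) .
  show T': "vderiv (unit_tangent \<gamma>) s = vderiv (vderiv \<gamma>) s"
    using vderiv_cong_open[OF assms(1,3) T] .
  then show "principal_normal \<gamma> s = sgn (vderiv (vderiv \<gamma>) s)"
    by (simp add: principal_normal_def)
qed

lemma unit_tangent_involute:
  assumes "open I" "smooth_curve_on I \<gamma>" "arc_length_param_on I \<gamma>" "s \<in> I" "c - s > 0"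
  shows "unit_tangent (involute c \<gamma>) s = principal_normal \<gamma> s"
proof -
  note frenet = unit_speed_frenet[OF assms(1,3)]
  note smooth = smooth_curve_on_differentiable[OF assms(2)]
  have "unit_tangent \<gamma> differentiable (at s)"
    using differentiable_cong_open[OF smooth(2) assms(1,4)] frenet(1) assms(4) by metis
  then have dT: "(unit_tangent \<gamma> has_vector_derivative vderiv (vderiv \<gamma>) s) (at s)"
    using frenet(2)[OF assms(4)] by (simp add: vderiv_works)
  have d\<gamma>: "(\<gamma> has_vector_derivative unit_tangent \<gamma> s) (at s)"
    using smooth(1)[OF assms(4)] frenet(1)[OF assms(4)] by (simp add: vderiv_works)
  have "((\<lambda>t. c - t) has_real_derivative -1) (at s)"
    by (auto intro!: derivative_eq_intros)
  from has_vector_derivative_add[OF d\<gamma> has_vector_derivative_scaleR[OF this dT]]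
  have "(involute c \<gamma> has_vector_derivative (c - s) *\<^sub>R vderiv (vderiv \<gamma>) s) (at s)"
    by (simp add: involute_def[abs_def])
  then have "vderiv (involute c \<gamma>) s = (c - s) *\<^sub>R vderiv (vderiv \<gamma>) s"
    by (rule vderiv_eqI)
  then show ?thesis
    using frenet(3)[OF assms(4)] assms(5) by (simp add: unit_tangent_def sgn_scaleR)
qed

theorem theorem14:
  fixes \<gamma> :: "real \<Rightarrow> real^3" and I :: "real set" and c :: real
  assumes "open I" and "is_interval I" and "I \<noteq> {}"
    and "smooth_curve_on I \<gamma>"
    and "arc_length_param_on I \<gamma>"
    and "\<forall>s\<in>I. curvature \<gamma> s \<noteq> 0"
    and "\<forall>s\<in>I. c - s > 0"
    and "\<forall>s\<in>I. torsion (involute c \<gamma>) s \<noteq> 0"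
  shows "spherical_circle_on I (binormal (involute c \<gamma>)) \<longleftrightarrow> slant_helix_on I \<gamma>"
proof -
  let ?\<delta> = "involute c \<gamma>" and ?A = "vderiv (vderiv \<gamma>)"
  note I = assms(1,2)
  note smooth = smooth_curve_on_differentiable[OF assms(4)]
  have A: "?A s \<noteq> 0" if "s \<in> I" for s
    using assms(6) that unit_speed_frenet(2)[OF assms(1,5) that] by (auto simp: curvature_def)
  have T_N: "unit_tangent ?\<delta> s = principal_normal \<gamma> s" if "s \<in> I" for s
    using unit_tangent_involute assms that by blast
  have T_sgn: "sgn (?A s) = unit_tangent ?\<delta> s" if "s \<in> I" for s
    using T_N[OF that] unit_speed_frenet(3)[OF assms(1,5) that] by simp
  have tors: "torsion ?\<delta> s \<noteq> 0" if "s \<in> I" for s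
    using assms(8) that by blast
  have T: "unit_tangent ?\<delta> differentiable (at s)" if "s \<in> I" for s
    by (rule differentiable_cong_open[OF differentiable_sgn[OF smooth(3) A] I(1)])
      (use that T_sgn in auto)
  have T': "vderiv (unit_tangent ?\<delta>) differentiable (at s)" if "s \<in> I" for s
    by (rule differentiable_cong_open[OF twice_differentiable_sgn[OF I(1) _ smooth(3,4) A] I(1)])
      (use that in \<open>auto intro: vderiv_cong_open[OF I(1)] simp: T_sgn\<close>)
  have N: "principal_normal ?\<delta> differentiable (at s)" if "s \<in> I" for s
    unfolding principal_normal_def[abs_def]
    using differentiable_sgn[OF T' torsion_nonzero_imp_frenet(2)[OF tors]] that by blast
  have "spherical_circle_on I (binormal ?\<delta>)
      \<longleftrightarrow> (\<exists>d. d \<noteq> 0 \<and> (\<exists>a. \<forall>s\<in>I. binormal ?\<delta> s \<bullet> d = a))"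
    using frenet_binormal(1)[OF I(1) _ T N tors] by (rule spherical_circle_on_iff_height_constant)
  also have "\<dots> \<longleftrightarrow> (\<exists>d. d \<noteq> 0 \<and> (\<exists>a. \<forall>s\<in>I. unit_tangent ?\<delta> s \<bullet> d = a))"
    using tangent_height_constant_iff_binormal_height_constant[OF I T N tors] by simp
  also have "\<dots> \<longleftrightarrow> (\<exists>d. d \<noteq> 0 \<and> (\<exists>a. \<forall>s\<in>I. principal_normal \<gamma> s \<bullet> d = a))"
    using T_N by simp
  also have "\<dots> \<longleftrightarrow> slant_helix_on I \<gamma>"
    using T_N torsion_nonzero_imp_frenet(3)[OF tors]
    by (subst slant_helix_on_iff_height_constant) auto
  finally show ?thesis .
qed

end
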